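(* Let $\Pi$ be a Borel probability measure on $[0,1]$ (the prior on the basin size $s$) with $1\in\operatorname{supp}(\Pi)$. Then for every $0<\varepsilon<1$, the posterior probability $\Pi(A_\varepsilon\mid H_n)$ converges to $0$ exponentially fast in $n$. In particular, there exists $\eta$ with $0<\eta<\varepsilon$ such that $$\Pi(A_\varepsilon\mid H_n)\le \frac{(1-\varepsilon)^n\,\Pi(A_\varepsilon)}{(1-\eta)^n\,(1-\Pi(A_\eta))}$$ for all $n\ge1$ (with $\Pi(A_\eta)<1$).
   Context: For $\varepsilon\in(0,1)$, $A_\varepsilon:=\{s\in[0,1]: s\le 1-\varepsilon\}$. $H_n$ is the event that $n$ runs, conditionally independent given $s$ and each reaching a fixed outcome with probability $s$, all reach that outcome; its likelihood is $\mathbb P(H_n\mid s)=s^n$. The posterior is $\Pi(A\mid H_n)=\int_A s^n\,d\Pi(s)\big/\int_{[0,1]} s^n\,d\Pi(s)$ for Borel $A\subseteq[0,1]$. *)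

theory Defs
  imports "HOL-Probability.Probability"
begin

text \<open>
  A Borel probability measure on the unit interval is a measure \<open>prior :: real measure\<close> with
  \<open>prob_space prior\<close> and the trace \<open>\<sigma>\<close>-algebra of \<open>borel\<close> on \<open>{0..1}\<close>; so its space is \<open>{0..1}\<close>.
  Relatively open sets are the traces of open sets, hence the intersection with the space
  in the definition of the topological support.
\<close>

definition unit_borel :: "real measure" where
  "unit_borel = restrict_space borel {0..1}"

definition supp :: "'a::topological_space measure \<Rightarrow> 'a set" where
  "supp M = {x \<in> space M. \<forall>U. open U \<longrightarrow> x \<in> U \<longrightarrow> emeasure M (U \<inter> space M) > 0}"

definition A_set :: "real \<Rightarrow> real set" where
  "A_set e = {s \<in> {0..1}. s \<le> 1 - e}"

text \<open>
  Given \<open>s\<close>, the runs \<open>0, \<dots>, n - 1\<close> are independent, and \<open>w i\<close> says whether run \<open>i\<close> reaches the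
  fixed outcome. The value \<open>False\<close> is only the filler that \<open>Pi_pmf\<close> uses for indices \<open>i \<ge> n\<close>.
\<close>

definition runs :: "nat \<Rightarrow> real \<Rightarrow> (nat \<Rightarrow> bool) pmf" where
  "runs n s = Pi_pmf {..<n} False (\<lambda>_. bernoulli_pmf s)"

definition H :: "nat \<Rightarrow> (nat \<Rightarrow> bool) set" where
  "H n = {w. \<forall>i<n. w i}"

definition likelihood :: "nat \<Rightarrow> real \<Rightarrow> real" where
  "likelihood n s = measure_pmf.prob (runs n s) (H n)"

definition posterior :: "real measure \<Rightarrow> nat \<Rightarrow> real set \<Rightarrow> real" where
  "posterior prior n A =
     (LINT s:A|prior. likelihood n s) / (LINT s:{0..1}|prior. likelihood n s)"

definition exponentially_to_0 :: "(nat \<Rightarrow> real) \<Rightarrow> bool" where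
  "exponentially_to_0 X \<longleftrightarrow> (\<exists>C r. 0 < C \<and> 0 < r \<and> r < 1 \<and> (\<forall>n. \<bar>X n\<bar> \<le> C * r ^ n))"

lemma likelihood_eq_power:
  assumes "s \<in> {0..1}"
  shows "likelihood n s = s ^ n"
proof -
  have "H n = Pi {..<n} (\<lambda>_. {True})"
    by (auto simp: H_def)
  then have "likelihood n s = (\<Prod>i<n. measure_pmf.prob (bernoulli_pmf s) {True})"
    by (simp add: likelihood_def runs_def measure_Pi_pmf_Pi)
  then show ?thesis
    using assms by (simp add: measure_pmf_single)
qed

lemma posterior_eq:
  assumes "A \<subseteq> {0..1}"
  shows "posterior prior n A = (LINT s:A|prior. s ^ n) / (LINT s:{0..1}|prior. s ^ n)"
proof -
  have "(LINT s:B|prior. likelihood n s) = (LINT s:B|prior. s ^ n)" if "B \<subseteq> {0..1}" for B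
    unfolding set_lebesgue_integral_def
    by (rule Bochner_Integration.integral_cong)
       (use that in \<open>auto simp: indicator_def likelihood_eq_power\<close>)
  then show ?thesis
    using assms by (simp add: posterior_def)
qed

end

theory Submission
  imports Defs
begin

text \<open>
  Since \<open>1\<close> lies in the support, every \<open>\<eta> > 0\<close> leaves positive prior mass above \<open>1 - \<eta>\<close>.
  For \<open>\<eta> < \<epsilon>\<close> that mass contributes at least order \<open>(1 - \<eta>) ^ n\<close> to the normalising integral,
  whereas the integral over \<open>A_set \<epsilon>\<close> has order at most \<open>(1 - \<epsilon>) ^ n\<close>. The witness is
  \<open>\<eta> = \<epsilon> / 2\<close>.
\<close>

locale unit_prior = prob_space prior for prior :: "real measure" +
  assumes sets_prior: "sets prior = sets unit_borel"
begin

lemma space_prior: "space prior = {0..1}"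
  using sets_eq_imp_space_eq[OF sets_prior] by (simp add: unit_borel_def space_restrict_space)

lemma sets_priorI: "B \<in> sets borel \<Longrightarrow> B \<inter> {0..1} \<in> sets prior"
  by (auto simp: sets_prior unit_borel_def sets_restrict_space)

lemma A_set_in_sets [measurable]: "A_set e \<in> sets prior"
proof -
  have "A_set e = {..1 - e} \<inter> {0..1}"
    by (auto simp: A_set_def)
  then show ?thesis
    using sets_priorI[of "{..1 - e}"] by simp
qed

lemma borel_measurable_prior: "f \<in> borel_measurable borel \<Longrightarrow> f \<in> borel_measurable prior"
  unfolding measurable_cong_sets[OF sets_prior refl] unit_borel_def
  by (rule measurable_restrict_space1)

text \<open>On the unit interval \<open>s ^ n\<close> is bounded by 1, which suffices under a
  probability measure. This supplies the integrability needed to compare integrals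
  pointwise.\<close>

lemma integrable_indicator_power:
  assumes "B \<in> sets prior"
  shows "integrable prior (\<lambda>s. indicator B s * s ^ n :: real)"
proof (rule integrable_const_bound[where B = 1])
  show "AE s in prior. norm (indicator B s * s ^ n :: real) \<le> 1"
    by (rule AE_I2) (auto simp: space_prior indicator_def power_le_one)
  show "(\<lambda>s. indicator B s * s ^ n :: real) \<in> borel_measurable prior"
    by (rule borel_measurable_times[OF borel_measurable_indicator[OF assms] borel_measurable_prior])
      simp
qed

text \<open>The power is increasing on the nonnegative reals, so on \<open>A_set e\<close> it is at
  most its value at the cutoff \<open>1 - e\<close>. For \<open>e > 1\<close> the set is empty and
  both sides vanish.\<close>

lemma integral_power_A_set_le:
  "(LINT s:A_set e|prior. s ^ n) \<le> (1 - e) ^ n * prob (A_set e)"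
proof -
  have "(LINT s:A_set e|prior. s ^ n) = (\<integral>s. indicator (A_set e) s * s ^ n \<partial>prior)"
    by (simp add: set_lebesgue_integral_def)
  also have "\<dots> \<le> (\<integral>s. indicator (A_set e) s * (1 - e) ^ n \<partial>prior)"
  proof (rule integral_mono)
    show "integrable prior (\<lambda>s. indicator (A_set e) s * s ^ n)"
      by (rule integrable_indicator_power) simp
    show "integrable prior (\<lambda>s. indicator (A_set e) s * (1 - e) ^ n)"
      by (intro integrable_mult_left integrable_real_indicator) (auto simp: emeasure_eq_measure)
  qed (auto simp: A_set_def indicator_def intro!: power_mono)
  also have "\<dots> = (1 - e) ^ n * prob (A_set e)"
    using sets.sets_into_space[OF A_set_in_sets[of e]] by (simp add: Int_absorb2)
  finally show ?thesis .
qed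

lemma integral_power_ge:
  assumes "e \<le> 1"
  shows "(1 - e) ^ n * (1 - prob (A_set e)) \<le> (LINT s:{0..1}|prior. s ^ n)"
proof -
  let ?B = "space prior - A_set e"
  have "(1 - e) ^ n * (1 - prob (A_set e)) = (1 - e) ^ n * prob ?B"
    by (simp add: prob_compl)
  also have "\<dots> = (\<integral>s. indicator ?B s * (1 - e) ^ n \<partial>prior)"
    by (simp add: Int_absorb2)
  \<comment> \<open>On \<open>?B\<close> one has \<open>s > 1 - e \<ge> 0\<close>, so the power
    dominates the constant; on \<open>A_set e\<close> the left integrand is 0 and the right one
    nonnegative.\<close>
  also have "\<dots> \<le> (\<integral>s. indicator {0..1} s * s ^ n \<partial>prior)"
  proof (rule integral_mono)
    show "integrable prior (\<lambda>s. indicator {0..1} s * s ^ n :: real)"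
      using sets_priorI[of UNIV] by (intro integrable_indicator_power) simp
    show "integrable prior (\<lambda>s. indicator ?B s * (1 - e) ^ n)"
      by (intro integrable_mult_left integrable_real_indicator) (auto simp: emeasure_eq_measure)
  qed (use assms in \<open>auto simp: A_set_def space_prior indicator_def intro!: power_mono\<close>)
  also have "\<dots> = (LINT s:{0..1}|prior. s ^ n)"
    by (simp add: set_lebesgue_integral_def)
  finally show ?thesis .
qed

lemma posterior_A_set_nonneg: "0 \<le> posterior prior n (A_set e)"
proof -
  have "0 \<le> (LINT s:B|prior. s ^ n)" if "B \<subseteq> {0..1}" for B :: "real set"
    unfolding set_lebesgue_integral_def
    by (rule Bochner_Integration.integral_nonneg) (use that in \<open>auto simp: indicator_def space_prior\<close>)
  moreover have "A_set e \<subseteq> {0..1}"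
    by (auto simp: A_set_def)
  ultimately show ?thesis
    by (simp add: posterior_eq)
qed

text \<open>The numerator is bounded above with cutoff \<open>e\<close>, the denominator below with
  cutoff \<open>h\<close>. The conditions on \<open>h\<close> make the lower bound strictly
  positive, so the quotients can be compared.\<close>

lemma posterior_A_set_le:
  assumes "e \<le> 1" "h < 1" "prob (A_set h) < 1"
  shows "posterior prior n (A_set e) \<le>
    ((1 - e) ^ n * prob (A_set e)) / ((1 - h) ^ n * (1 - prob (A_set h)))"
proof -
  have "A_set e \<subseteq> {0..1}"
    by (auto simp: A_set_def)
  then show ?thesis
    using assms by (simp add: posterior_eq frac_le integral_power_A_set_le integral_power_ge)
qed

text \<open>The complement of \<open>A_set e\<close> is the trace of the open ray above
  \<open>1 - e\<close>, a neighbourhood of 1, so the support condition gives it positive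
  mass.\<close>

lemma prob_A_set_less_1:
  assumes "1 \<in> supp prior" "0 < e"
  shows "prob (A_set e) < 1"
proof -
  have "space prior - A_set e = {1 - e<..} \<inter> space prior"
    by (auto simp: A_set_def space_prior)
  moreover have "0 < emeasure prior ({1 - e<..} \<inter> space prior)"
    using assms by (auto simp: supp_def)
  ultimately show ?thesis
    using prob_compl[of "A_set e"] by (simp add: emeasure_eq_measure)
qed

end

theorem proposition5p2:
  fixes prior :: "real measure" and \<epsilon> :: real
  assumes "prob_space prior"
    and "sets prior = sets unit_borel"
    and "1 \<in> supp prior"
    and "0 < \<epsilon>" and "\<epsilon> < 1"
  shows "exponentially_to_0 (\<lambda>n. posterior prior n (A_set \<epsilon>)) \<and>
    (\<exists>\<eta>. 0 < \<eta> \<and> \<eta> < \<epsilon> \<and> measure prior (A_set \<eta>) < 1 \<and>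
      (\<forall>n\<ge>1. posterior prior n (A_set \<epsilon>) \<le>
         ((1 - \<epsilon>) ^ n * measure prior (A_set \<epsilon>)) /
         ((1 - \<eta>) ^ n * (1 - measure prior (A_set \<eta>)))))"
proof -
  interpret unit_prior prior
    using assms(1,2) by (simp add: unit_prior_def unit_prior_axioms_def)
  define \<eta> where "\<eta> = \<epsilon> / 2"
  have \<eta>: "0 < \<eta>" "\<eta> < \<epsilon>"
    using assms by (auto simp: \<eta>_def)
  have less_1: "prob (A_set \<eta>) < 1"
    using assms(3) \<eta>(1) by (rule prob_A_set_less_1)
  \<comment> \<open>This covers \<open>n = 0\<close> too, as \<open>exponentially_to_0\<close>
    quantifies over all \<open>n\<close>.\<close>
  have bound: "posterior prior n (A_set \<epsilon>) \<le>
      ((1 - \<epsilon>) ^ n * prob (A_set \<epsilon>)) / ((1 - \<eta>) ^ n * (1 - prob (A_set \<eta>)))" for n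
    using assms(5) \<eta>(2) less_1 by (intro posterior_A_set_le) auto
  \<comment> \<open>The ratio \<open>r\<close> is below 1 because
    \<open>\<eta> < \<epsilon>\<close>. Replacing \<open>prob (A_set \<epsilon>)\<close> by 1 keeps
    \<open>C\<close> positive even if \<open>A_set \<epsilon>\<close> is a null set.\<close>
  define C r where "C = 1 / (1 - prob (A_set \<eta>))" and "r = (1 - \<epsilon>) / (1 - \<eta>)"
  have "\<bar>posterior prior n (A_set \<epsilon>)\<bar> \<le> C * r ^ n" for n
  proof -
    have "\<bar>posterior prior n (A_set \<epsilon>)\<bar> = posterior prior n (A_set \<epsilon>)"
      by (simp add: posterior_A_set_nonneg)
    also have "\<dots> \<le> ((1 - \<epsilon>) ^ n * prob (A_set \<epsilon>)) / ((1 - \<eta>) ^ n * (1 - prob (A_set \<eta>)))"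
      by (rule bound)
    also have "\<dots> \<le> ((1 - \<epsilon>) ^ n * 1) / ((1 - \<eta>) ^ n * (1 - prob (A_set \<eta>)))"
      using assms(5) \<eta>(2) less_1 by (intro divide_right_mono mult_left_mono) auto
    also have "\<dots> = C * r ^ n"
      by (simp add: C_def r_def power_divide)
    finally show ?thesis .
  qed
  moreover have "0 < C" "0 < r" "r < 1"
    using assms(5) \<eta> less_1 by (auto simp: C_def r_def)
  ultimately have "exponentially_to_0 (\<lambda>n. posterior prior n (A_set \<epsilon>))"
    unfolding exponentially_to_0_def by blast
  then show ?thesis
    using \<eta> less_1 bound by blast
qed

end
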